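(* Let $\mathcal{K}$ be a pointed closed convex cone in a finite-dimensional real inner product space $\mathcal{E}$. If $\mathcal{K}$ is amenable, then $\mathcal{K}$ is nice and, in particular, facially exposed.
   Context: $\|x\|=\sqrt{\langle x,x\rangle}$ and $\operatorname{dist}(x,C)=\inf\{\|x-y\|: y\in C\}$. A convex cone is a nonempty set closed under nonnegative linear combinations; it is pointed if $\mathcal{K}\cap-\mathcal{K}=\{0\}$. A face of $\mathcal{K}$ is a convex cone $\mathcal{F}\subseteq\mathcal{K}$ such that $x,y\in\mathcal{K}$, $x+y\in\mathcal{F}$ imply $x,y\in\mathcal{F}$. The dual cone is $\mathcal{K}^*=\{x:\langle x,y\rangle\ge0\ \forall y\in\mathcal{K}\}$ and $C^\perp=\{x:\langle x,y\rangle=0\ \forall y\in C\}$. $\mathcal{K}$ is amenable if for every face $\mathcal{F}$ of $\mathcal{K}$ there is $\kappa>0$ such that $\operatorname{dist}(x,\mathcal{F})\le\kappa\operatorname{dist}(x,\mathcal{K})$ for all $x\in\operatorname{span}\mathcal{F}$. $\mathcal{K}$ is nice if $\mathcal{K}^*+\mathcal{F}^\perp$ is closed for every face $\mathcal{F}$ of $\mathcal{K}$. $\mathcal{K}$ is facially exposed if every face $\mathcal{F}$ of $\mathcal{K}$ is of the form $\mathcal{F}=\mathcal{K}\cap\{z\}^\perp$ for some $z\in\mathcal{K}^*$. *)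

theory Defs
  imports "HOL-Analysis.Analysis"
begin

definition pointed :: "'a::real_vector set \<Rightarrow> bool"
  where "pointed K \<longleftrightarrow> K \<inter> uminus ` K = {0}"

(* Unlike the library relation face_of, this one requires the face to be a convex cone,
   so the empty set is not a face. *)
definition cone_face :: "'a::real_vector set \<Rightarrow> 'a set \<Rightarrow> bool"
  where "cone_face F K \<longleftrightarrow>
    convex_cone F \<and> F \<subseteq> K \<and> (\<forall>x\<in>K. \<forall>y\<in>K. x + y \<in> F \<longrightarrow> x \<in> F \<and> y \<in> F)"

definition dual_cone :: "'a::real_inner set \<Rightarrow> 'a set"
  where "dual_cone K = {x. \<forall>y\<in>K. x \<bullet> y \<ge> 0}"

(* infdist x C is the infimum of the distances for nonempty C; faces and cones are nonempty,
   so its convention for the empty set never matters here. *)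
definition amenable :: "'a::real_inner set \<Rightarrow> bool"
  where "amenable K \<longleftrightarrow>
    (\<forall>F. cone_face F K \<longrightarrow>
      (\<exists>\<kappa>>0. \<forall>x\<in>span F. infdist x F \<le> \<kappa> * infdist x K))"

definition nice :: "'a::real_inner set \<Rightarrow> bool"
  where "nice K \<longleftrightarrow> (\<forall>F. cone_face F K \<longrightarrow> closed (dual_cone K + F\<^sup>\<bottom>))"

definition facially_exposed :: "'a::real_inner set \<Rightarrow> bool"
  where "facially_exposed K \<longleftrightarrow>
    (\<forall>F. cone_face F K \<longrightarrow> (\<exists>z\<in>dual_cone K. F = K \<inter> {z}\<^sup>\<bottom>))"

end

theory Submission
  imports Defs
begin

text \<open>
  Niceness: for a face \<open>F\<close> one shows \<open>K\<^sup>* + F\<^sup>\<bottom> = F\<^sup>*\<close>, and dual cones are closed. Given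
  \<open>y \<in> F\<^sup>*\<close>, let \<open>p\<close> be its projection onto \<open>span F\<close>. On \<open>span F\<close> one has
  \<open>- p \<bullet> x \<le> \<parallel>p\<parallel> dist(x, F) \<le> \<kappa> \<parallel>p\<parallel> dist(x, K)\<close> by amenability. The right-hand side is sublinear,
  so by Hahn--Banach \<open>- p\<close> extends to a functional dominated by it everywhere; its negative is
  nonnegative on \<open>K\<close> and agrees with \<open>y\<close> on \<open>F\<close>.

  Exposedness: let \<open>G\<close> be the smallest exposed face containing \<open>F\<close>. If \<open>F \<noteq> G\<close>, there is a
  functional in \<open>G\<^sup>* \<inter> F\<^sup>\<bottom>\<close> that does not vanish on \<open>G\<close>. Niceness for \<open>G\<close> changes it by an element
  of \<open>G\<^sup>\<bottom>\<close> into an element of \<open>K\<^sup>*\<close>, which exposes a face that contains \<open>F\<close> but not \<open>G\<close>.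
\<close>

subsection \<open>Finite-dimensional inner product spaces\<close>

text \<open>Finite dimension enters as a finite spanning set of a \<open>real_inner\<close> type.
  The basis is chosen inside \<open>V\<close> itself, so that sums of its vectors stay in a cone
  when \<open>V\<close> is one.\<close>

lemma finite_spanning_subset:
  fixes V :: "'a::real_vector set"
  assumes "\<exists>B::'a set. finite B \<and> span B = UNIV"
  obtains C where "finite C" "C \<subseteq> V" "independent C" "span C = span V"
proof -
  obtain B :: "'a set" where B: "finite B" "span B = UNIV" using assms by blast
  obtain C where C: "C \<subseteq> V" "independent C" "V \<subseteq> span C"
    using maximal_independent_subset by blast
  have "finite C" using independent_span_bound[OF B(1) C(2)] B(2) by auto
  moreover have "span C = span V"
    using C by (metis span_mono span_span subset_antisym)
  ultimately show ?thesis using C that by blast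
qed

lemma orthogonal_decomposition_span:
  fixes x :: "'a::real_inner"
  assumes "finite C"
  obtains u v where "u \<in> span C" "x = u + v" "\<And>w. w \<in> span C \<Longrightarrow> v \<bullet> w = 0"
proof -
  obtain D where D: "finite D" "span D = span C" "pairwise orthogonal D"
    using basis_orthogonal[OF assms] by blast
  \<comment> \<open>\<open>D\<close> may contain 0. Its coefficient is then 0 by the convention for
    division, and \<open>u \<bullet> d = x \<bullet> d\<close> still holds.\<close>
  define u where "u = (\<Sum>d\<in>D. ((x \<bullet> d) / (d \<bullet> d)) *\<^sub>R d)"
  have "u \<in> span D"
    unfolding u_def by (intro span_sum span_scale span_base)
  moreover have "orthogonal (x - u) d" if "d \<in> D" for d
  proof -
    have "u \<bullet> d = (\<Sum>e\<in>D. if e = d then x \<bullet> d else 0)"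
      unfolding u_def inner_sum_left
      using D(3) that by (intro sum.cong) (auto simp: pairwise_def orthogonal_def)
    also have "\<dots> = x \<bullet> d" using D(1) that by simp
    finally show ?thesis by (simp add: orthogonal_def inner_diff_left)
  qed
  then have "(x - u) \<bullet> w = 0" if "w \<in> span D" for w
    using orthogonal_to_span[OF that] by (simp add: orthogonal_def)
  ultimately show ?thesis using that[of u "x - u"] D(2) by auto
qed

text \<open>One-dimensional extension, with functionals represented by vectors. Replacing
  \<open>b\<close> by its component \<open>c\<close> orthogonal to \<open>span C\<close> allows any
  value at \<open>c\<close> by adding a multiple of \<open>c\<close>, without changing the values on
  \<open>span C\<close>.\<close>

lemma Hahn_Banach_inner_step:
  fixes p :: "'a::real_inner \<Rightarrow> real"
  assumes add: "\<And>x y. p (x + y) \<le> p x + p y"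
    and scale: "\<And>r x. 0 < r \<Longrightarrow> p (r *\<^sub>R x) = r * p x"
    and C: "finite C" and le: "\<And>x. x \<in> span C \<Longrightarrow> y \<bullet> x \<le> p x"
  obtains z where "\<And>x. x \<in> span C \<Longrightarrow> z \<bullet> x = y \<bullet> x"
    and "\<And>x. x \<in> span (insert b C) \<Longrightarrow> z \<bullet> x \<le> p x"
proof (cases "b \<in> span C")
  case True
  then have "span (insert b C) = span C" by (rule span_redundant)
  then show ?thesis using that[of y] le by simp
next
  case False
  obtain u c where u: "u \<in> span C" "b = u + c" and c: "\<And>w. w \<in> span C \<Longrightarrow> c \<bullet> w = 0"
    using orthogonal_decomposition_span[OF C, of b] by metis
  have c0: "c \<bullet> c \<noteq> 0" using False u by auto
  define A where "A = (\<lambda>x. y \<bullet> x - p (x - c)) ` span C"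
  \<comment> \<open>Subadditivity for \<open>x + w = (x - c) + (w + c)\<close> puts every lower
    bound for the value at \<open>c\<close> below every upper bound, so the supremum
    \<open>a\<close> of the lower bounds meets both.\<close>
  have ub: "y \<bullet> x - p (x - c) \<le> p (w + c) - y \<bullet> w" if "x \<in> span C" "w \<in> span C" for x w
    using le[OF span_add[OF that]] add[of "x - c" "w + c"]
    by (simp add: inner_add_right algebra_simps)
  define a where "a = Sup A"
  have bdd: "bdd_above A" unfolding A_def using ub span_zero by (intro bdd_aboveI2) blast
  have lower: "y \<bullet> x - p (x - c) \<le> a" if "x \<in> span C" for x
    unfolding a_def using bdd that by (intro cSup_upper) (auto simp: A_def)
  have upper: "a \<le> p (x + c) - y \<bullet> x" if "x \<in> span C" for x
    unfolding a_def using ub that span_zero by (intro cSup_least) (auto simp: A_def)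
  define z where "z = y + ((a - y \<bullet> c) / (c \<bullet> c)) *\<^sub>R c"
  have zC: "z \<bullet> x = y \<bullet> x" if "x \<in> span C" for x
    using c[OF that] by (simp add: z_def inner_add_left)
  have zc: "z \<bullet> c = a" using c0 by (simp add: z_def inner_add_left)
  have "z \<bullet> x \<le> p x" if x: "x \<in> span (insert b C)" for x
  proof -
    obtain r where r: "x - r *\<^sub>R b \<in> span C" using x span_breakdown_eq by blast
    define w where "w = x - r *\<^sub>R b + r *\<^sub>R u"
    have w: "w \<in> span C" unfolding w_def using r u by (intro span_add span_scale)
    have xw: "x = w + r *\<^sub>R c" by (simp add: w_def u algebra_simps)
    have zx: "z \<bullet> x = y \<bullet> w + r * a" by (simp add: xw inner_add_right zC[OF w] zc)
    \<comment> \<open>Dividing by the absolute value of \<open>r\<close> reduces the last two cases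
      to the coefficients 1 and -1 of \<open>c\<close>, where \<open>upper\<close> and
      \<open>lower\<close> apply.\<close>
    consider "r = 0" | "r > 0" | "r < 0" by linarith
    then show ?thesis
    proof cases
      case 1
      then show ?thesis using le[OF w] zx xw by simp
    next
      case 2
      have "a \<le> p ((1/r) *\<^sub>R w + c) - y \<bullet> ((1/r) *\<^sub>R w)"
        using w by (intro upper span_scale)
      then have "r * a \<le> r * p ((1/r) *\<^sub>R w + c) - y \<bullet> w"
        using 2 by (simp add: field_simps)
      also have "r * p ((1/r) *\<^sub>R w + c) = p (r *\<^sub>R ((1/r) *\<^sub>R w + c))"
        using 2 scale by simp
      also have "r *\<^sub>R ((1/r) *\<^sub>R w + c) = x" using 2 by (simp add: xw scaleR_add_right)
      finally show ?thesis using zx by simp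
    next
      case 3
      define s where "s = - r"
      have s: "s > 0" "r = - s" using 3 by (auto simp: s_def)
      have "y \<bullet> ((1/s) *\<^sub>R w) - p ((1/s) *\<^sub>R w - c) \<le> a"
        using w by (intro lower span_scale)
      then have "y \<bullet> w - s * p ((1/s) *\<^sub>R w - c) \<le> s * a"
        using s by (simp add: field_simps)
      moreover have "s * p ((1/s) *\<^sub>R w - c) = p (s *\<^sub>R ((1/s) *\<^sub>R w - c))"
        using s scale by simp
      moreover have "s *\<^sub>R ((1/s) *\<^sub>R w - c) = x" using s by (simp add: xw scaleR_diff_right)
      ultimately show ?thesis using zx s by simp
    qed
  qed
  with zC show ?thesis using that by blast
qed

lemma Hahn_Banach_inner_span:
  fixes p :: "'a::real_inner \<Rightarrow> real"
  assumes add: "\<And>x y. p (x + y) \<le> p x + p y"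
    and scale: "\<And>r x. 0 < r \<Longrightarrow> p (r *\<^sub>R x) = r * p x"
    and "finite B" "finite C" and le: "\<And>x. x \<in> span C \<Longrightarrow> y \<bullet> x \<le> p x"
  shows "\<exists>z. (\<forall>x\<in>span C. z \<bullet> x = y \<bullet> x) \<and> (\<forall>x\<in>span (B \<union> C). z \<bullet> x \<le> p x)"
  using \<open>finite B\<close>
proof induction
  case empty
  then show ?case using le by auto
next
  case (insert b B)
  then obtain z where z: "\<forall>x\<in>span C. z \<bullet> x = y \<bullet> x" "\<forall>x\<in>span (B \<union> C). z \<bullet> x \<le> p x"
    by blast
  have "finite (B \<union> C)" using insert.hyps \<open>finite C\<close> by simp
  then obtain z' where z': "\<And>x. x \<in> span (B \<union> C) \<Longrightarrow> z' \<bullet> x = z \<bullet> x"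
    "\<And>x. x \<in> span (insert b (B \<union> C)) \<Longrightarrow> z' \<bullet> x \<le> p x"
    using Hahn_Banach_inner_step[where p=p and C="B \<union> C" and y=z and b=b] add scale z(2) by metis
  have "span C \<subseteq> span (B \<union> C)" by (intro span_mono) simp
  then show ?case using z z' by (intro exI[of _ z']) auto
qed

lemma Hahn_Banach_inner:
  fixes p :: "'a::real_inner \<Rightarrow> real"
  assumes fin: "\<exists>B::'a set. finite B \<and> span B = UNIV"
    and "\<And>x y. p (x + y) \<le> p x + p y"
    and "\<And>r x. 0 < r \<Longrightarrow> p (r *\<^sub>R x) = r * p x"
    and "\<And>x. x \<in> span V \<Longrightarrow> y \<bullet> x \<le> p x"
  obtains z where "\<And>x. x \<in> span V \<Longrightarrow> z \<bullet> x = y \<bullet> x" "\<And>x. z \<bullet> x \<le> p x"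
proof -
  obtain B :: "'a set" where B: "finite B" "span B = UNIV" using fin by blast
  obtain C where C: "finite C" "span C = span V"
    using finite_spanning_subset[OF fin] by metis
  have "span (B \<union> C) = UNIV"
    using B(2) span_mono[of B "B \<union> C"] by auto
  then have "\<exists>z. (\<forall>x\<in>span V. z \<bullet> x = y \<bullet> x) \<and> (\<forall>x. z \<bullet> x \<le> p x)"
    using Hahn_Banach_inner_span[where p=p and B=B and C=C and y=y] assms(2-4) B(1) C by simp
  then show ?thesis using that by blast
qed

subsection \<open>Convex cones\<close>

lemma convex_cone_set_plus:
  assumes "convex_cone S" "convex_cone T"
  shows "convex_cone (S + T)"
proof -
  have "S + T = (\<Union>x\<in>S. \<Union>y\<in>T. {x + y})" by (auto simp: set_plus_def)
  then show ?thesis using convex_cone_sums[OF assms] by simp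
qed

lemma convex_cone_sum:
  assumes "convex_cone S" "\<And>i. i \<in> I \<Longrightarrow> f i \<in> S"
  shows "sum f I \<in> S"
  using assms(2)
  by (induction I rule: infinite_finite_induct)
    (auto intro: convex_cone_add convex_cone_contains_0 assms(1))

section \<open>Distance to a convex cone\<close>

lemma le_infdist_iff:
  assumes "A \<noteq> {}"
  shows "c \<le> infdist x A \<longleftrightarrow> (\<forall>a\<in>A. c \<le> dist x a)"
proof
  assume "c \<le> infdist x A"
  then show "\<forall>a\<in>A. c \<le> dist x a" using infdist_le order_trans by blast
next
  assume "\<forall>a\<in>A. c \<le> dist x a"
  then show "c \<le> infdist x A" using assms by (auto simp: infdist_notempty intro: cINF_greatest)
qed

text \<open>Together with positive homogeneity this makes the distance sublinear, hence a dominating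
  function for Hahn-Banach. The infimum is taken over \<open>a\<close> with \<open>b\<close> fixed,
  then over \<open>b\<close>.\<close>

lemma infdist_convex_cone_add:
  fixes K :: "'a::real_normed_vector set"
  assumes K: "convex_cone K"
  shows "infdist (x + y) K \<le> infdist x K + infdist y K"
proof -
  have ne: "K \<noteq> {}" using K by (rule convex_cone_nonempty)
  have "infdist (x + y) K - dist y b \<le> dist x a" if "a \<in> K" "b \<in> K" for a b
  proof -
    have "infdist (x + y) K \<le> dist (x + y) (a + b)"
      using convex_cone_add[OF K that] by (rule infdist_le)
    then show ?thesis using norm_diff_triangle_ineq[of x y a b] by (simp add: dist_norm)
  qed
  then have "infdist (x + y) K - dist y b \<le> infdist x K" if "b \<in> K" for b
    unfolding le_infdist_iff[OF ne] using that by blast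
  then have "infdist (x + y) K - infdist x K \<le> dist y b" if "b \<in> K" for b
    using that by (simp add: diff_le_eq add.commute)
  then have "infdist (x + y) K - infdist x K \<le> infdist y K"
    unfolding le_infdist_iff[OF ne] by blast
  then show ?thesis by simp
qed

lemma infdist_convex_cone_scaleR:
  fixes K :: "'a::real_normed_vector set"
  assumes K: "convex_cone K" and r: "0 < r"
  shows "infdist (r *\<^sub>R x) K = r * infdist x K"
proof -
  have ne: "K \<noteq> {}" using K by (rule convex_cone_nonempty)
  have le: "infdist (s *\<^sub>R z) K \<le> s * infdist z K" if s: "0 < s" for s z
  proof -
    have "infdist (s *\<^sub>R z) K / s \<le> dist z a" if a: "a \<in> K" for a
    proof -
      have "infdist (s *\<^sub>R z) K \<le> dist (s *\<^sub>R z) (s *\<^sub>R a)"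
        using convex_cone_scaleR[OF K _ a] s by (intro infdist_le) simp
      also have "\<dots> = s * dist z a"
        using s by (simp add: dist_norm flip: scaleR_diff_right)
      finally show ?thesis using s by (simp add: field_simps)
    qed
    then have "infdist (s *\<^sub>R z) K / s \<le> infdist z K" by (simp add: le_infdist_iff[OF ne])
    then show ?thesis using s by (simp add: field_simps)
  qed
  \<comment> \<open>The reverse inequality is \<open>le\<close> for the factor \<open>1/r\<close> at
    the point \<open>r *\<^sub>R x\<close>.\<close>
  have "infdist ((1/r) *\<^sub>R (r *\<^sub>R x)) K \<le> (1/r) * infdist (r *\<^sub>R x) K"
    using r by (intro le) simp
  then have "r * infdist x K \<le> infdist (r *\<^sub>R x) K" using r by (simp add: field_simps)
  with le[OF r] show ?thesis by (rule antisym)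
qed

text \<open>Take \<open>e\<close> as the sum of a basis of \<open>span G\<close> chosen from
  \<open>G\<close>. All its coordinates are 1, and a small \<open>w\<close> has coordinates of
  absolute value at most 1, so \<open>e + w\<close> is a nonnegative combination of elements of
  \<open>G\<close>.\<close>

lemma convex_cone_relative_interior_point:
  fixes G :: "'a::real_inner set"
  assumes fin: "\<exists>B::'a set. finite B \<and> span B = UNIV" and G: "convex_cone G"
  obtains e \<epsilon> where "e \<in> G" "0 < \<epsilon>" "\<And>w. w \<in> span G \<Longrightarrow> norm w < \<epsilon> \<Longrightarrow> e + w \<in> G"
proof -
  obtain C where C: "finite C" "C \<subseteq> G" "independent C" "span C = span G"
    using finite_spanning_subset[OF fin] by metis
  \<comment> \<open>The part of \<open>b\<close> orthogonal to the other basis vectors reads off the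
    coordinate at \<open>b\<close>, up to a nonzero factor.\<close>
  have "\<exists>v. v \<bullet> b \<noteq> 0 \<and> (\<forall>w\<in>span (C - {b}). v \<bullet> w = 0)" if b: "b \<in> C" for b
  proof -
    obtain u v where uv: "u \<in> span (C - {b})" "b = u + v"
      "\<And>w. w \<in> span (C - {b}) \<Longrightarrow> v \<bullet> w = 0"
      using orthogonal_decomposition_span[of "C - {b}" b] C(1) by (metis finite_Diff)
    have "v \<noteq> 0" using C(3) b uv(1,2) by (auto simp: dependent_def)
    moreover have "v \<bullet> b = v \<bullet> v" using uv by (simp add: inner_add_right)
    ultimately show ?thesis using uv(3) by (intro exI[of _ v]) simp
  qed
  then obtain v where v: "\<And>b. b \<in> C \<Longrightarrow> v b \<bullet> b \<noteq> 0"
    "\<And>b w. b \<in> C \<Longrightarrow> w \<in> span (C - {b}) \<Longrightarrow> v b \<bullet> w = 0"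
    by metis
  \<comment> \<open>By Cauchy-Schwarz the coordinate of \<open>w\<close> at \<open>b\<close> is at
    most \<open>k b * norm w\<close> in absolute value. The sum in \<epsilon> handles all
    \<open>b\<close> at once, and the added 1 covers an empty basis.\<close>
  define k where "k b = norm (v b) / \<bar>v b \<bullet> b\<bar>" for b
  define \<epsilon> where "\<epsilon> = 1 / (1 + (\<Sum>b\<in>C. k b))"
  have k0: "k b \<ge> 0" for b by (simp add: k_def)
  then have s0: "(\<Sum>b\<in>C. k b) \<ge> 0" by (simp add: sum_nonneg)
  then have eps: "\<epsilon> > 0" by (simp add: \<epsilon>_def)
  have "\<Sum>C + w \<in> G" if w: "w \<in> span G" "norm w < \<epsilon>" for w
  proof -
    obtain c where c: "w = (\<Sum>b\<in>C. c b *\<^sub>R b)"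
      using w(1) C(1,4) span_finite[of C] by auto
    have "\<bar>c b\<bar> \<le> 1" if b: "b \<in> C" for b
    proof -
      have "v b \<bullet> w = (\<Sum>d\<in>C. if d = b then c b * (v b \<bullet> b) else 0)"
        unfolding c inner_sum_right
        using b by (intro sum.cong) (auto intro: v(2)[OF b] span_base)
      then have "v b \<bullet> w = c b * (v b \<bullet> b)" using C(1) b by simp
      then have "\<bar>c b\<bar> * \<bar>v b \<bullet> b\<bar> \<le> norm (v b) * norm w"
        using Cauchy_Schwarz_ineq2[of "v b" w] by (simp add: abs_mult)
      then have "\<bar>c b\<bar> \<le> k b * norm w" using v(1)[OF b] by (simp add: k_def field_simps)
      also have "\<dots> \<le> k b * \<epsilon>" using k0 w(2) by (intro mult_left_mono) auto
      also have "\<dots> \<le> (1 + (\<Sum>b\<in>C. k b)) * \<epsilon>"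
        using member_le_sum[of b C k] k0 b C(1) eps by (intro mult_right_mono) auto
      also have "\<dots> = 1" using s0 by (simp add: \<epsilon>_def)
      finally show ?thesis .
    qed
    then have "0 \<le> 1 + c b" if "b \<in> C" for b using that by (fastforce simp: abs_le_iff)
    then have "(1 + c b) *\<^sub>R b \<in> G" if "b \<in> C" for b
      using that C(2) by (intro convex_cone_scaleR[OF G]) auto
    then have "(\<Sum>b\<in>C. (1 + c b) *\<^sub>R b) \<in> G" by (intro convex_cone_sum[OF G])
    then show ?thesis by (simp add: c scaleR_add_left sum.distrib)
  qed
  moreover have "\<Sum>C \<in> G" using C(2) by (intro convex_cone_sum[OF G]) auto
  ultimately show ?thesis using that eps by blast
qed

section \<open>Dual cones and orthogonal complements\<close>

lemma convex_cone_dual_cone: "convex_cone (dual_cone K)"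
  by (simp add: convex_cone_iff dual_cone_def inner_add_left)

lemma closed_dual_cone: "closed (dual_cone K)"
proof -
  have "dual_cone K = (\<Inter>y\<in>K. {x. y \<bullet> x \<ge> 0})"
    by (auto simp: dual_cone_def inner_commute)
  then show ?thesis by (auto intro: closed_halfspace_ge)
qed

lemma mem_orthogonal_comp: "x \<in> W\<^sup>\<bottom> \<longleftrightarrow> (\<forall>y\<in>W. x \<bullet> y = 0)"
  by (auto simp: orthogonal_comp_def orthogonal_def inner_commute)

subsection \<open>Amenable cones\<close>

lemma amenable_dual_cone_face:
  fixes K :: "'a::real_inner set"
  assumes fin: "\<exists>B::'a set. finite B \<and> span B = UNIV"
    and K: "convex_cone K" and am: "amenable K" and F: "cone_face F K"
  shows "dual_cone F = dual_cone K + F\<^sup>\<bottom>"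
proof
  have FK: "F \<subseteq> K" and Fc: "convex_cone F" using F by (auto simp: cone_face_def)
  show "dual_cone K + F\<^sup>\<bottom> \<subseteq> dual_cone F"
    using FK by (auto simp: set_plus_def dual_cone_def mem_orthogonal_comp inner_add_left)
  show "dual_cone F \<subseteq> dual_cone K + F\<^sup>\<bottom>"
  proof
    fix y assume y: "y \<in> dual_cone F"
    obtain C where C: "finite C" "span C = span F"
      using finite_spanning_subset[OF fin] by metis
    obtain q r where qr: "y = q + r" "\<And>w. w \<in> span F \<Longrightarrow> r \<bullet> w = 0"
      using orthogonal_decomposition_span[OF C(1), of y] C(2) by metis
    have q: "q \<bullet> f \<ge> 0" if "f \<in> F" for f
      using y that qr(2)[OF span_base[OF that]] by (auto simp: dual_cone_def qr(1) inner_add_left)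
    obtain \<kappa> where k: "\<kappa> > 0" "\<And>x. x \<in> span F \<Longrightarrow> infdist x F \<le> \<kappa> * infdist x K"
      using am F by (auto simp: amenable_def)
    \<comment> \<open>The projection of \<open>y\<close> onto \<open>span F\<close> is
      \<open>q\<close> here, while \<open>p\<close> is the dominating sublinear function.\<close>
    define p where "p x = norm q * \<kappa> * infdist x K" for x
    have "(- q) \<bullet> x \<le> p x" if x: "x \<in> span F" for x
    proof (cases "q = 0")
      case True
      then show ?thesis by (simp add: p_def)
    next
      case False
      have "((- q) \<bullet> x) / norm q \<le> dist x f" if "f \<in> F" for f
      proof -
        have "(- q) \<bullet> x \<le> (- q) \<bullet> (x - f)" using q[OF that] by (simp add: inner_diff_right)
        also have "\<dots> \<le> norm q * dist x f"
          using norm_cauchy_schwarz[of "- q" "x - f"] by (simp add: dist_norm)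
        finally show ?thesis using False by (simp add: field_simps)
      qed
      then have "((- q) \<bullet> x) / norm q \<le> infdist x F"
        by (simp add: le_infdist_iff convex_cone_nonempty[OF Fc])
      also have "\<dots> \<le> \<kappa> * infdist x K" using k(2)[OF x] .
      finally show ?thesis using False by (simp add: p_def field_simps)
    qed
    moreover have "p (a + b) \<le> p a + p b" for a b
    proof -
      have "norm q * \<kappa> * infdist (a + b) K \<le> norm q * \<kappa> * (infdist a K + infdist b K)"
        using infdist_convex_cone_add[OF K] k(1) by (intro mult_left_mono) auto
      then show ?thesis by (simp add: p_def distrib_left)
    qed
    moreover have "p (s *\<^sub>R x) = s * p x" if "0 < s" for s x
      using infdist_convex_cone_scaleR[OF K that] by (simp add: p_def)
    ultimately obtain z where z: "\<And>x. x \<in> span F \<Longrightarrow> z \<bullet> x = (- q) \<bullet> x" "\<And>x. z \<bullet> x \<le> p x"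
      using Hahn_Banach_inner[OF fin, where p=p and V=F and y="- q"] by metis
    \<comment> \<open>On \<open>K\<close> the distance is 0, so \<open>p\<close> forces
      \<open>z\<close> to be nonpositive there. On \<open>F\<close>, \<open>z\<close> agrees with
      \<open>- q\<close> and hence with \<open>- y\<close>, so \<open>y + z\<close> vanishes on
      \<open>F\<close>.\<close>
    have "z \<bullet> x \<le> 0" if "x \<in> K" for x using z(2)[of x] that by (simp add: p_def)
    then have "- z \<in> dual_cone K" by (auto simp: dual_cone_def)
    moreover have "y + z \<in> F\<^sup>\<bottom>"
      using qr z(1) by (auto simp: mem_orthogonal_comp inner_add_left span_base)
    ultimately have "- z + (y + z) \<in> dual_cone K + F\<^sup>\<bottom>" by (rule set_plus_intro)
    then show "y \<in> dual_cone K + F\<^sup>\<bottom>" by simp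
  qed
qed

text \<open>A relative interior point \<open>e\<close> of \<open>G\<close> lies outside the proper
  face \<open>F\<close>, and then \<open>- e\<close> lies outside the cone \<open>T = G - F\<close>.
  The functional comes from separating \<open>- 2 *\<^sub>R e\<close> from \<open>T\<close>.\<close>

lemma cone_face_supporting_functional:
  fixes G :: "'a::real_inner set"
  assumes fin: "\<exists>B::'a set. finite B \<and> span B = UNIV"
    and G: "convex_cone G" and F: "cone_face F G" and "F \<noteq> G"
  obtains z e where "z \<in> dual_cone G" "z \<in> F\<^sup>\<bottom>" "e \<in> G" "0 < z \<bullet> e"
proof -
  have FG: "F \<subseteq> G" and Fc: "convex_cone F"
    and face: "\<And>x y. x \<in> G \<Longrightarrow> y \<in> G \<Longrightarrow> x + y \<in> F \<Longrightarrow> x \<in> F"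
    using F by (auto simp: cone_face_def)
  obtain e \<epsilon> where e: "e \<in> G" and eps: "0 < \<epsilon>"
    and ball: "\<And>w. w \<in> span G \<Longrightarrow> norm w < \<epsilon> \<Longrightarrow> e + w \<in> G"
    using convex_cone_relative_interior_point[OF fin G] by metis
  \<comment> \<open>If \<open>e\<close> were in \<open>F\<close>, then for \<open>x\<close> in
    \<open>G\<close> the splitting of \<open>e\<close> into \<delta> times \<open>x\<close> and the
    remainder, both in \<open>G\<close>, would put \<open>x\<close> into \<open>F\<close>.\<close>
  have "e \<notin> F"
  proof
    assume eF: "e \<in> F"
    have "x \<in> F" if x: "x \<in> G" for x
    proof -
      define \<delta> where "\<delta> = \<epsilon> / (1 + norm x)"
      have d: "\<delta> > 0" using eps by (simp add: \<delta>_def add_pos_nonneg)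
      have "norm (- (\<delta> *\<^sub>R x)) < \<epsilon>"
        using eps by (simp add: \<delta>_def field_simps add_pos_nonneg)
      moreover have "- (\<delta> *\<^sub>R x) \<in> span G" using x by (intro span_neg span_scale span_base)
      ultimately have "e + - (\<delta> *\<^sub>R x) \<in> G" by (intro ball)
      moreover have "\<delta> *\<^sub>R x \<in> G" using convex_cone_scaleR[OF G _ x] d by simp
      ultimately have "\<delta> *\<^sub>R x \<in> F" using face[of "\<delta> *\<^sub>R x" "e + - (\<delta> *\<^sub>R x)"] eF by simp
      moreover have "0 \<le> 1/\<delta>" using d by simp
      ultimately have "(1/\<delta>) *\<^sub>R (\<delta> *\<^sub>R x) \<in> F"
        using convex_cone_scaleR[OF Fc] by blast
      then show ?thesis using d by simp
    qed
    then show False using FG \<open>F \<noteq> G\<close> by auto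
  qed
  define T where "T = G + uminus ` F"
  have T: "convex_cone T"
    unfolding T_def by (intro convex_cone_set_plus G convex_cone_negations Fc)
  have GT: "g \<in> T" if "g \<in> G" for g
    using set_plus_intro[OF that, of 0 "uminus ` F"] convex_cone_contains_0[OF Fc]
    by (force simp: T_def)
  have FT: "- f \<in> T" if "f \<in> F" for f
    using set_plus_intro[OF convex_cone_contains_0[OF G], of "- f" "uminus ` F"] that
    by (auto simp: T_def)
  have neT: "- e \<notin> T"
  proof
    assume "- e \<in> T"
    then obtain g f where gf: "g \<in> G" "f \<in> F" "- e = g + - f"
      by (auto simp: T_def set_plus_def)
    then have "e + g = f" by (simp add: algebra_simps)
    then show False using face[OF e gf(1)] gf(2) \<open>e \<notin> F\<close> by simp
  qed
  have TG: "T \<subseteq> span G"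
    using FG by (auto simp: T_def set_plus_def intro!: span_diff intro: span_base)
  \<comment> \<open>\<open>T\<close> is not known to be closed, so a point outside it might have
    distance 0. Doubling helps: if \<open>t\<close> in \<open>T\<close> were within \<epsilon> of
    \<open>v\<close>, then \<open>e + (v - t)\<close> would be in \<open>G\<close>, and adding
    \<open>t\<close> would give \<open>- e\<close> in \<open>T\<close>.\<close>
  define v where "v = - (2 *\<^sub>R e)"
  have "\<epsilon> \<le> infdist v T"
    unfolding le_infdist_iff[OF convex_cone_nonempty[OF T]]
  proof (rule ballI, rule ccontr)
    fix t assume t: "t \<in> T" and "\<not> \<epsilon> \<le> dist v t"
    then have "norm (v - t) < \<epsilon>" by (simp add: dist_norm)
    moreover have "v - t \<in> span G"
      unfolding v_def using t TG e by (intro span_diff span_neg span_scale) (auto intro: span_base)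
    ultimately have "e + (v - t) \<in> T" by (intro GT ball)
    then have "e + (v - t) + t \<in> T" using t by (rule convex_cone_add[OF T])
    moreover have "e + (v - t) + t = - e" by (simp add: v_def scaleR_2)
    ultimately show False using neT by simp
  qed
  then have d: "infdist v T > 0" using eps by simp
  then have v0: "v \<noteq> 0" using convex_cone_contains_0[OF T] by auto
  \<comment> \<open>Scaled so that the functional equals the distance to \<open>T\<close> on the ray
    through \<open>v\<close>; on the opposite ray it is nonpositive.\<close>
  define y where "y = (infdist v T / (v \<bullet> v)) *\<^sub>R v"
  have yv: "y \<bullet> v = infdist v T" using v0 by (simp add: y_def)
  have "y \<bullet> x \<le> infdist x T" if x: "x \<in> span {v}" for x
  proof -
    obtain r where r: "x = r *\<^sub>R v" using x by (auto simp: span_singleton)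
    show ?thesis
    proof (cases "r > 0")
      case True
      then show ?thesis using infdist_convex_cone_scaleR[OF T True] yv r by simp
    next
      case False
      then have "y \<bullet> x \<le> 0" using yv d by (simp add: r mult_nonpos_nonneg)
      then show ?thesis using infdist_nonneg order_trans by blast
    qed
  qed
  then obtain z where z: "\<And>x. x \<in> span {v} \<Longrightarrow> z \<bullet> x = y \<bullet> x" "\<And>x. z \<bullet> x \<le> infdist x T"
    using Hahn_Banach_inner[OF fin, where p="\<lambda>x. infdist x T" and V="{v}" and y=y]
      infdist_convex_cone_add[OF T] infdist_convex_cone_scaleR[OF T] by metis
  have zT: "z \<bullet> t \<le> 0" if "t \<in> T" for t using z(2)[of t] that by simp
  have "- z \<in> dual_cone G" using zT GT by (auto simp: dual_cone_def)
  \<comment> \<open>Both \<open>f\<close> and \<open>- f\<close> lie in \<open>T\<close> for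
    \<open>f\<close> in \<open>F\<close>, so \<open>z\<close> vanishes on \<open>F\<close>.\<close>
  moreover have "- z \<in> F\<^sup>\<bottom>"
    using zT[OF FT] zT[OF GT] FG by (force simp: mem_orthogonal_comp)
  moreover have "0 < - z \<bullet> e"
    using z(1)[OF span_base, of v] yv d by (simp add: v_def)
  ultimately show ?thesis using that e by blast
qed

text \<open>Sum a finite subset of \<open>Z\<close> that spans \<open>span Z\<close>. Its members
  are nonnegative on \<open>K\<close>, so where the sum vanishes on \<open>K\<close> each of them
  does, and with them all of \<open>Z\<close>.\<close>

lemma smallest_exposed_face:
  fixes K :: "'a::real_inner set"
  assumes fin: "\<exists>B::'a set. finite B \<and> span B = UNIV"
  obtains z where "z \<in> dual_cone K" "z \<in> F\<^sup>\<bottom>"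
    "\<And>w x. w \<in> dual_cone K \<Longrightarrow> w \<in> F\<^sup>\<bottom> \<Longrightarrow> x \<in> K \<Longrightarrow> z \<bullet> x = 0 \<Longrightarrow> w \<bullet> x = 0"
proof -
  define Z where "Z = dual_cone K \<inter> F\<^sup>\<bottom>"
  obtain C where C: "finite C" "C \<subseteq> Z" "span C = span Z"
    using finite_spanning_subset[OF fin] by metis
  have "\<Sum>C \<in> dual_cone K"
    using C(2) by (intro convex_cone_sum[OF convex_cone_dual_cone]) (auto simp: Z_def)
  moreover have "\<Sum>C \<in> F\<^sup>\<bottom>"
    using C(2) by (intro subspace_sum[OF subspace_orthogonal_comp]) (auto simp: Z_def)
  moreover have "w \<bullet> x = 0" if w: "w \<in> dual_cone K" "w \<in> F\<^sup>\<bottom>" and x: "x \<in> K" "\<Sum>C \<bullet> x = 0" for w x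
  proof -
    have "c \<bullet> x \<ge> 0" if "c \<in> C" for c using that C(2) x(1) by (auto simp: Z_def dual_cone_def)
    then have "\<forall>c\<in>C. c \<bullet> x = 0"
      using x(2) C(1) by (simp add: inner_sum_left sum_nonneg_eq_0_iff)
    moreover have "w \<in> span C" using w C(3) by (simp add: Z_def span_base)
    ultimately show ?thesis
      using orthogonal_to_span[of w C x] by (auto simp: orthogonal_def inner_commute)
  qed
  ultimately show ?thesis using that by blast
qed

lemma cone_face_exposed:
  assumes K: "convex_cone K" and z: "z \<in> dual_cone K"
  shows "cone_face (K \<inter> {z}\<^sup>\<bottom>) K"
proof -
  have "convex_cone (K \<inter> {z}\<^sup>\<bottom>)"
    using K by (auto simp: convex_cone_iff mem_orthogonal_comp inner_add_left)
  moreover have "x \<bullet> z = 0 \<and> y \<bullet> z = 0" if "x \<in> K" "y \<in> K" "(x + y) \<bullet> z = 0" for x y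
  proof -
    have "x \<bullet> z \<ge> 0" "y \<bullet> z \<ge> 0" using that z by (auto simp: dual_cone_def inner_commute)
    then show ?thesis using that(3) by (simp add: inner_add_left)
  qed
  ultimately show ?thesis by (auto simp: cone_face_def mem_orthogonal_comp)
qed

lemma amenable_imp_facially_exposed:
  fixes K :: "'a::real_inner set"
  assumes fin: "\<exists>B::'a set. finite B \<and> span B = UNIV"
    and K: "convex_cone K" and am: "amenable K"
  shows "facially_exposed K"
  unfolding facially_exposed_def
proof (intro allI impI)
  fix F assume F: "cone_face F K"
  obtain z where z: "z \<in> dual_cone K" "z \<in> F\<^sup>\<bottom>" and
    min: "\<And>w x. w \<in> dual_cone K \<Longrightarrow> w \<in> F\<^sup>\<bottom> \<Longrightarrow> x \<in> K \<Longrightarrow> z \<bullet> x = 0 \<Longrightarrow> w \<bullet> x = 0"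
    using smallest_exposed_face[OF fin] by metis
  define G where "G = K \<inter> {z}\<^sup>\<bottom>"
  have G: "cone_face G K" unfolding G_def using K z(1) by (rule cone_face_exposed)
  then have Gc: "convex_cone G" by (simp add: cone_face_def)
  have FG: "F \<subseteq> G"
    using F z(2) by (auto simp: G_def cone_face_def mem_orthogonal_comp inner_commute)
  then have FfG: "cone_face F G" using F by (auto simp: cone_face_def G_def)
  have "F = G"
  proof (rule ccontr)
    assume "F \<noteq> G"
    then obtain q e where q: "q \<in> dual_cone G" "q \<in> F\<^sup>\<bottom>" "e \<in> G" "0 < q \<bullet> e"
      using cone_face_supporting_functional[OF fin Gc FfG] by metis
    \<comment> \<open>Amenability is used for the exposed face \<open>G\<close>, not for
      \<open>F\<close>. It replaces \<open>q\<close> by some \<open>k\<close> that is nonnegative on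
      all of \<open>K\<close> and unchanged on \<open>G\<close>.\<close>
    have "q \<in> dual_cone K + G\<^sup>\<bottom>"
      using q(1) amenable_dual_cone_face[OF fin K am G] by simp
    then obtain k h where kh: "k \<in> dual_cone K" "h \<in> G\<^sup>\<bottom>" "q = k + h"
      by (auto simp: set_plus_def)
    have kq: "k \<bullet> x = q \<bullet> x" if "x \<in> G" for x
      using that kh by (simp add: mem_orthogonal_comp inner_add_left)
    have "k \<in> F\<^sup>\<bottom>" using kq FG q(2) by (auto simp: mem_orthogonal_comp)
    \<comment> \<open>By minimality of \<open>G\<close>, \<open>k\<close> vanishes wherever
      \<open>z\<close> does on \<open>K\<close>, in particular at \<open>e\<close>.\<close>
    then have "k \<bullet> e = 0"
      using min[OF kh(1)] q(3) by (auto simp: G_def mem_orthogonal_comp inner_commute)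
    then show False using kq[OF q(3)] q(4) by simp
  qed
  then show "\<exists>z\<in>dual_cone K. F = K \<inter> {z}\<^sup>\<bottom>" using z(1) G_def by blast
qed

theorem proposition13:
  fixes K :: "'a::real_inner set"
  assumes "\<exists>B::'a set. finite B \<and> span B = UNIV"
    and "convex_cone K" and "closed K" and "pointed K"
    and "amenable K"
  shows "nice K \<and> facially_exposed K"
proof
  show "nice K"
    unfolding nice_def
    using amenable_dual_cone_face[OF assms(1,2,5)] closed_dual_cone by metis
  show "facially_exposed K"
    using assms(1,2,5) by (rule amenable_imp_facially_exposed)
qed

end
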